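(* Fix a diffusion time $t$. For $\square\in\{\nu,\omega\}$ and point clouds $O_s,O_e\in\mathcal{O}$ let $\rho_{\square;t}(\cdot\mid O_e):\mathbb{R}^3\to\mathbb{R}_{\ge0}$ (density fields) and $\widetilde{s}_{\square;t}(\cdot,\cdot\mid O_s,O_e):SE(3)\times\mathbb{R}^3\to\mathbb{R}^3$ (score fields) be given, such that the integrals below are well defined. Define the score model $s_t(g\mid O_s,O_e)=s_{\nu;t}(g\mid O_s,O_e)\oplus s_{\omega;t}(g\mid O_s,O_e)\in\mathbb{R}^3\oplus\mathbb{R}^3\cong\mathfrak{se}(3)$ by $$s_{\nu;t}(g\mid O_s,O_e)=\int_{\mathbb{R}^3}d^3x\;\rho_{\nu;t}(x\mid O_e)\,\widetilde{s}_{\nu;t}(g,x\mid O_s,O_e),$$ $$s_{\omega;t}(g\mid O_s,O_e)=\int_{\mathbb{R}^3}d^3x\;\rho_{\omega;t}(x\mid O_e)\,\widetilde{s}_{\omega;t}(g,x\mid O_s,O_e)+\int_{\mathbb{R}^3}d^3x\;\rho_{\nu;t}(x\mid O_e)\;x\wedge\widetilde{s}_{\nu;t}(g,x\mid O_s,O_e).$$ Suppose that for $\square=\omega,\nu$ and for all $\Delta g=(\Delta p,\Delta R)\in SE(3)$, $g\in SE(3)$, $x\in\mathbb{R}^3$, $O_s,O_e\in\mathcal{O}$: $$\rho_{\square;t}(\Delta g\,x\mid\Delta g\cdot O_e)=\rho_{\square;t}(x\mid O_e),$$ $$\widetilde{s}_{\square;t}(\Delta g\,g,x\mid\Delta g\cdot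 O_s,O_e)=\widetilde{s}_{\square;t}(g,x\mid O_s,O_e),$$ $$\widetilde{s}_{\square;t}(g\,\Delta g^{-1},\Delta g\,x\mid O_s,\Delta g\cdot O_e)=\Delta R\,\widetilde{s}_{\square;t}(g,x\mid O_s,O_e).$$ Then for all $\Delta g,g\in SE(3)$ and $O_s,O_e\in\mathcal{O}$, $$s_t(\Delta g\,g\mid\Delta g\cdot O_s,O_e)=s_t(g\mid O_s,O_e),\qquad s_t(g\,\Delta g^{-1}\mid O_s,\Delta g\cdot O_e)=\left[\mathrm{Ad}_{\Delta g}\right]^{-T}s_t(g\mid O_s,O_e).$$
   Context: $\mathcal{O}$ is the set of point clouds in $\mathbb{R}^3$, on which $SE(3)$ acts from the left by rigid motion of the points, written $\Delta g\cdot O$. Elements of $SE(3)$ are written $g=(p,R)$ with $p\in\mathbb{R}^3$, $R\in SO(3)$, acting on $x\in\mathbb{R}^3$ by $g\,x=Rx+p$. The symbol $\wedge$ denotes the cross product on $\mathbb{R}^3$. Vectors in $\mathfrak{se}(3)\cong\mathbb{R}^6$ have their translational part $\nu$ in the first three components and rotational part $\omega$ in the last three. The adjoint representation is, for $g=(p,R)$, $$\mathrm{Ad}_g=\begin{bmatrix}R&[p]^{\wedge}R\\0&R\end{bmatrix},$$ where $[p]^{\wedge}$ is the $3\times3$ skew-symmetric matrix with $[p]^{\wedge}x=p\times x$, and $A^{-T}$ denotes the inverse transpose of $A$. *)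

theory Defs
  imports "HOL-Analysis.Analysis"
begin

type_synonym se3 = "(real^3) \<times> (real^3^3)"

definition SE3 :: "se3 set" where
  "SE3 = {(p, R). orthogonal_matrix R \<and> det R = 1}"

fun se3_act :: "se3 \<Rightarrow> real^3 \<Rightarrow> real^3" where
  "se3_act (p, R) x = R *v x + p"

fun se3_mult :: "se3 \<Rightarrow> se3 \<Rightarrow> se3" where
  "se3_mult (p, R) (q, S) = (R *v q + p, R ** S)"

fun se3_inv :: "se3 \<Rightarrow> se3" where
  "se3_inv (p, R) = (- (transpose R *v p), transpose R)"

lemma se3_act_mult: "se3_act (se3_mult g h) x = se3_act g (se3_act h x)"
  by (cases g; cases h)
     (simp add: matrix_vector_mul_assoc matrix_vector_right_distrib add.assoc)

lemma se3_mult_closed: "g \<in> SE3 \<Longrightarrow> h \<in> SE3 \<Longrightarrow> se3_mult g h \<in> SE3"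
  by (cases g; cases h) (auto simp: SE3_def orthogonal_matrix_mul det_mul)

lemma se3_inv_closed: "g \<in> SE3 \<Longrightarrow> se3_inv g \<in> SE3"
  by (cases g) (auto simp: SE3_def orthogonal_matrix_transpose)

lemma se3_mult_inv:
  assumes "g \<in> SE3"
  shows "se3_mult (se3_inv g) g = (0, mat 1)" and "se3_mult g (se3_inv g) = (0, mat 1)"
proof -
  obtain p R where g: "g = (p, R)" by (cases g)
  have R: "transpose R ** R = mat 1" "R ** transpose R = mat 1"
    using assms by (auto simp: g SE3_def orthogonal_matrix_def)
  have neg: "R *v (- q) = - (R *v q)" for q
    by (rule linear_neg[OF matrix_vector_mul_linear])
  show "se3_mult (se3_inv g) g = (0, mat 1)"
    by (simp add: g R)
  show "se3_mult g (se3_inv g) = (0, mat 1)"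
    by (simp only: g se3_mult.simps se3_inv.simps neg matrix_vector_mul_assoc R
        matrix_vector_mul_lid) simp
qed

type_synonym point_cloud = "(real^3) set"

definition point_clouds :: "point_cloud set" where
  "point_clouds = {P. finite P}"

definition cloud_act :: "se3 \<Rightarrow> point_cloud \<Rightarrow> point_cloud" where
  "cloud_act g P = se3_act g ` P"

text \<open>
  Vectors of \<open>\<real>\<^sup>6 = \<real>\<^sup>3 \<oplus> \<real>\<^sup>3\<close> are indexed by the six-element type \<open>3 + 3\<close>: \<open>Inl\<close> indices are the
  first three (translational) components, \<open>Inr\<close> indices the last three (rotational) ones.
\<close>

type_synonym twist = "real^(3 + 3)"

definition direct_sum :: "real^3 \<Rightarrow> real^3 \<Rightarrow> twist" where
  "direct_sum u v = (\<chi> i. case i of Inl a \<Rightarrow> u $ a | Inr b \<Rightarrow> v $ b)"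

definition block_matrix ::
  "real^3^3 \<Rightarrow> real^3^3 \<Rightarrow> real^3^3 \<Rightarrow> real^3^3 \<Rightarrow> real^(3 + 3)^(3 + 3)" where
  "block_matrix A B C D =
     (\<chi> i j. case i of
        Inl a \<Rightarrow> (case j of Inl b \<Rightarrow> A $ a $ b | Inr b \<Rightarrow> B $ a $ b)
      | Inr a \<Rightarrow> (case j of Inl b \<Rightarrow> C $ a $ b | Inr b \<Rightarrow> D $ a $ b))"

definition hat :: "real^3 \<Rightarrow> real^3^3" where
  "hat p = matrix (cross3 p)"

lemma hat_mult_vec: "hat p *v x = cross3 p x"
proof -
  have "linear (cross3 p)"
    using bilinear_cross by (simp add: bilinear_def)
  then show ?thesis
    by (simp add: hat_def matrix_works)
qed

fun Ad :: "se3 \<Rightarrow> real^(3 + 3)^(3 + 3)" where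
  "Ad (p, R) = block_matrix R (hat p ** R) 0 R"

definition inv_transpose :: "real^'n^'n \<Rightarrow> real^'n^'n" where
  "inv_transpose A = transpose (matrix_inv A)"

text \<open>The two values of the index \<open>\<nu>, \<omega>\<close> (translational, rotational).\<close>

datatype part = Nu | Omega

type_synonym density_fields = "part \<Rightarrow> point_cloud \<Rightarrow> real^3 \<Rightarrow> real"

type_synonym score_fields =
  "part \<Rightarrow> se3 \<Rightarrow> real^3 \<Rightarrow> point_cloud \<Rightarrow> point_cloud \<Rightarrow> real^3"

definition score_nu ::
  "density_fields \<Rightarrow> score_fields \<Rightarrow> se3 \<Rightarrow> point_cloud \<Rightarrow> point_cloud \<Rightarrow> real^3" where
  "score_nu \<rho> s g Os Oe = (LINT x|lebesgue. \<rho> Nu Oe x *\<^sub>R s Nu g x Os Oe)"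

definition score_omega ::
  "density_fields \<Rightarrow> score_fields \<Rightarrow> se3 \<Rightarrow> point_cloud \<Rightarrow> point_cloud \<Rightarrow> real^3" where
  "score_omega \<rho> s g Os Oe =
     (LINT x|lebesgue. \<rho> Omega Oe x *\<^sub>R s Omega g x Os Oe) +
     (LINT x|lebesgue. \<rho> Nu Oe x *\<^sub>R cross3 x (s Nu g x Os Oe))"

definition score ::
  "density_fields \<Rightarrow> score_fields \<Rightarrow> se3 \<Rightarrow> point_cloud \<Rightarrow> point_cloud \<Rightarrow> twist" where
  "score \<rho> s g Os Oe = direct_sum (score_nu \<rho> s g Os Oe) (score_omega \<rho> s g Os Oe)"

text \<open>
  The Bochner integral of a non-integrable function is \<open>0\<close> by convention, so that the
  integrals defining the score exist has to be required separately.
\<close>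

definition score_integrals_exist :: "density_fields \<Rightarrow> score_fields \<Rightarrow> bool" where
  "score_integrals_exist \<rho> s \<longleftrightarrow>
     (\<forall>g\<in>SE3. \<forall>Os\<in>point_clouds. \<forall>Oe\<in>point_clouds.
        integrable lebesgue (\<lambda>x. \<rho> Nu Oe x *\<^sub>R s Nu g x Os Oe) \<and>
        integrable lebesgue (\<lambda>x. \<rho> Omega Oe x *\<^sub>R s Omega g x Os Oe) \<and>
        integrable lebesgue (\<lambda>x. \<rho> Nu Oe x *\<^sub>R cross3 x (s Nu g x Os Oe)))"

end

theory Submission
  imports Defs
begin

text \<open>
  The first identity holds already for the integrands. For the second, substitute
  \<open>x \<mapsto> R x + p\<close>, which preserves Lebesgue measure: all integrands are rotated by \<open>R\<close>, and since
  the lever arm in the torque integral is shifted by \<open>p\<close>, that integral gains the extra term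
  \<open>p \<and> R s\<^sub>\<nu>\<close>. This is exactly the lower left block \<open>[p] R\<close> of the inverse transpose of \<open>Ad (p, R)\<close>.
\<close>

text \<open>Row-by-column sums over the index type \<open>3 + 3\<close> split this way, which is
  what the two block product rules below rest on.\<close>

lemma sum_UNIV_sum_type:
  fixes f :: "'a::finite + 'b::finite \<Rightarrow> 'c::comm_monoid_add"
  shows "(\<Sum>k\<in>UNIV. f k) = (\<Sum>a\<in>UNIV. f (Inl a)) + (\<Sum>b\<in>UNIV. f (Inr b))"
  using sum.Plus[of "UNIV :: 'a set" "UNIV :: 'b set" f] by simp

lemma block_matrix_mult:
  "block_matrix A B C D ** block_matrix A' B' C' D' =
   block_matrix (A ** A' + B ** C') (A ** B' + B ** D') (C ** A' + D ** C') (C ** B' + D ** D')"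
  by (simp add: vec_eq_iff block_matrix_def matrix_matrix_mult_def sum_UNIV_sum_type split: sum.split)

lemma block_matrix_mult_direct_sum:
  "block_matrix A B C D *v direct_sum u v = direct_sum (A *v u + B *v v) (C *v u + D *v v)"
  by (simp add: vec_eq_iff block_matrix_def direct_sum_def matrix_vector_mult_def
      sum_UNIV_sum_type split: sum.split)

lemma transpose_block_matrix:
  "transpose (block_matrix A B C D) =
   block_matrix (transpose A) (transpose C) (transpose B) (transpose D)"
  by (simp add: vec_eq_iff block_matrix_def transpose_def split: sum.split)

lemma block_matrix_mat_1: "block_matrix (mat 1) 0 0 (mat 1) = mat 1"
  by (simp add: vec_eq_iff block_matrix_def mat_def split: sum.split)

text \<open>\<open>matrix_inv\<close> is a Hilbert choice of a two-sided inverse. For square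
  matrices a right inverse is two-sided, so the choice succeeds, and inverses are unique.\<close>

lemma matrix_inv_unique_left:
  fixes A :: "real^'n^'n"
  assumes "A ** B = mat 1"
  shows "matrix_inv A = B"
proof -
  have "B ** A = mat 1"
    using assms matrix_left_right_inverse by blast
  with assms have "matrix_inv A ** A = mat 1"
    unfolding matrix_inv_def by (metis (mono_tags, lifting) someI)
  then show ?thesis
    using assms by (metis matrix_mul_assoc matrix_mul_lid matrix_mul_rid)
qed

lemma transpose_hat: "transpose (hat p) = - hat p"
  by (simp add: hat_def vec_eq_iff transpose_def matrix_def cross3_def forall_3 axis_def)

text \<open>The transpose of the claimed matrix is a right inverse of \<open>Ad (p, R)\<close>: as
  \<open>R\<close> is orthogonal and \<open>hat p\<close> skew-symmetric, the upper right block of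
  the product is \<open>- hat p + hat p\<close>.\<close>

lemma inv_transpose_Ad:
  assumes "orthogonal_matrix R"
  shows "inv_transpose (Ad (p, R)) = block_matrix R 0 (hat p ** R) R"
proof -
  have R: "R ** transpose R = mat 1"
    using assms by (simp add: orthogonal_matrix_def)
  let ?B = "transpose (block_matrix R 0 (hat p ** R) R)"
  have "hat p ** R ** transpose R = hat p"
    by (simp add: R flip: matrix_mul_assoc)
  moreover have "R ** (transpose R ** - hat p) = - hat p"
    by (simp add: R matrix_mul_assoc)
  moreover have "transpose (0 :: real^3^3) = 0"
    by (simp add: transpose_def vec_eq_iff)
  ultimately have "Ad (p, R) ** ?B = mat 1"
    by (simp add: transpose_block_matrix block_matrix_mult matrix_transpose_mul
        R transpose_hat block_matrix_mat_1)
  then show ?thesis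
    by (simp add: inv_transpose_def matrix_inv_unique_left)
qed

text \<open>A rigid motion is a bijection with derivative \<open>R\<close> everywhere, so the
  Jacobian factor in the change of variables is \<open>\<bar>det R\<bar> = 1\<close>.\<close>

lemma lebesgue_integral_se3_act:
  fixes f :: "real^3 \<Rightarrow> real^3"
  assumes "dg \<in> SE3"
  shows "(LINT x|lebesgue. f (se3_act dg x)) = (LINT x|lebesgue. f x)"
proof -
  obtain p R where pR: "dg = (p, R)"
    by (cases dg)
  have R: "orthogonal_matrix R" "det R = 1"
    using assms by (auto simp: pR SE3_def)
  have act: "se3_act dg = (\<lambda>x. R *v x + p)"
    by (simp add: pR fun_eq_iff)
  have deriv: "(se3_act dg has_derivative (*v) R) (at x within UNIV)" for x
    unfolding act
    by (rule has_derivative_add_const, rule bounded_linear_imp_has_derivative,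
        rule matrix_vector_mul_bounded_linear)
  have inverse: "se3_act (se3_inv dg) (se3_act dg x) = x" "se3_act dg (se3_act (se3_inv dg) x) = x" for x
    using se3_mult_inv[OF assms] by (simp_all flip: se3_act_mult)
  have inj: "inj (se3_act dg)"
    using inverse(1) by (rule inj_on_inverseI)
  have range: "range (se3_act dg) = UNIV"
    using inverse(2) by (rule surjI)
  \<comment> \<open>The change of variables theorem concerns the gauge integral; keeping its value
    \<open>b\<close> arbitrary transfers integrability and value together.\<close>
  have *: "(integrable lebesgue (\<lambda>x. f (se3_act dg x)) \<and>
        integral UNIV (\<lambda>x. f (se3_act dg x)) = b) \<longleftrightarrow>
      (integrable lebesgue f \<and> integral UNIV f = b)" for b
    using has_absolute_integral_change_of_variables[OF _ deriv inj, of f b]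
    by (simp add: R range set_integrable_def)
  show ?thesis
  \<comment> \<open>For integrable functions the gauge and Lebesgue integrals agree. Otherwise
    neither integrand is integrable and both sides are the default \<open>0\<close>.\<close>
  proof (cases "integrable lebesgue f")
    case True
    with * show ?thesis
      by (metis integral_lebesgue)
  next
    case False
    with * show ?thesis
      by (metis not_integrable_integral_eq)
  qed
qed

theorem proposition5:
  fixes t :: real
    and \<rho> :: "real \<Rightarrow> density_fields"
    and s :: "real \<Rightarrow> score_fields"
  assumes rho_nonneg:
      "\<And>sq Oe x. Oe \<in> point_clouds \<Longrightarrow> 0 \<le> \<rho> t sq Oe x"
    and integrals: "score_integrals_exist (\<rho> t) (s t)"
    and rho_inv:
      "\<And>sq dg x Oe. dg \<in> SE3 \<Longrightarrow> Oe \<in> point_clouds \<Longrightarrow>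
         \<rho> t sq (cloud_act dg Oe) (se3_act dg x) = \<rho> t sq Oe x"
    and s_left_inv:
      "\<And>sq dg g x Os Oe. dg \<in> SE3 \<Longrightarrow> g \<in> SE3 \<Longrightarrow>
         Os \<in> point_clouds \<Longrightarrow> Oe \<in> point_clouds \<Longrightarrow>
         s t sq (se3_mult dg g) x (cloud_act dg Os) Oe = s t sq g x Os Oe"
    and s_right_equiv:
      "\<And>sq dp dR g x Os Oe. (dp, dR) \<in> SE3 \<Longrightarrow> g \<in> SE3 \<Longrightarrow>
         Os \<in> point_clouds \<Longrightarrow> Oe \<in> point_clouds \<Longrightarrow>
         s t sq (se3_mult g (se3_inv (dp, dR))) (se3_act (dp, dR) x) Os (cloud_act (dp, dR) Oe)
           = dR *v s t sq g x Os Oe"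
  shows "\<forall>dg\<in>SE3. \<forall>g\<in>SE3. \<forall>Os\<in>point_clouds. \<forall>Oe\<in>point_clouds.
           score (\<rho> t) (s t) (se3_mult dg g) (cloud_act dg Os) Oe
             = score (\<rho> t) (s t) g Os Oe \<and>
           score (\<rho> t) (s t) (se3_mult g (se3_inv dg)) Os (cloud_act dg Oe)
             = inv_transpose (Ad dg) *v score (\<rho> t) (s t) g Os Oe"
proof (intro ballI conjI)
  fix dg g Os Oe
  assume dg: "dg \<in> SE3" and g: "g \<in> SE3" and Os: "Os \<in> point_clouds" and Oe: "Oe \<in> point_clouds"
  show "score (\<rho> t) (s t) (se3_mult dg g) (cloud_act dg Os) Oe = score (\<rho> t) (s t) g Os Oe"
    by (simp add: score_def score_nu_def score_omega_def s_left_inv[OF dg g Os Oe])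
  obtain p R where pR: "dg = (p, R)"
    by (cases dg)
  have R: "orthogonal_matrix R" "det R = 1"
    using dg by (auto simp: pR SE3_def)
  let ?g' = "se3_mult g (se3_inv dg)" and ?Oe' = "cloud_act dg Oe"
  have s_eq: "s t sq ?g' (se3_act dg x) Os ?Oe' = R *v s t sq g x Os Oe" for sq x
    using s_right_equiv[of p R] dg g Os Oe by (simp add: pR)
  \<comment> \<open>Oriented so that an integrand is moved to the points
    \<open>se3_act dg x\<close>, the form in which \<open>rho_inv\<close> and \<open>s_eq\<close>
    apply.\<close>
  note change = lebesgue_integral_se3_act[OF dg, symmetric]
  have int:
    "integrable lebesgue (\<lambda>x. \<rho> t Nu Oe x *\<^sub>R s t Nu g x Os Oe)"
    "integrable lebesgue (\<lambda>x. \<rho> t Omega Oe x *\<^sub>R s t Omega g x Os Oe)"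
    "integrable lebesgue (\<lambda>x. \<rho> t Nu Oe x *\<^sub>R cross3 x (s t Nu g x Os Oe))"
    using integrals g Os Oe by (auto simp: score_integrals_exist_def)
  have R_bl: "bounded_linear ((*v) R)"
    by (rule matrix_vector_mul_bounded_linear)
  have "linear (cross3 p)"
    using bilinear_cross by (simp add: bilinear_def)
  then have pR_bl: "bounded_linear (\<lambda>y. cross3 p (R *v y))"
    using bounded_linear_compose[OF linear_conv_bounded_linear[THEN iffD1] R_bl] by blast
  \<comment> \<open>Kept general in \<open>sq\<close>: \<open>Nu\<close> gives the translational
    score, \<open>Omega\<close> the first integral of the rotational one.\<close>
  have integral_R: "(LINT x|lebesgue. \<rho> t sq ?Oe' x *\<^sub>R s t sq ?g' x Os ?Oe') =
      R *v (LINT x|lebesgue. \<rho> t sq Oe x *\<^sub>R s t sq g x Os Oe)" for sq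
  proof -
    have int_sq: "integrable lebesgue (\<lambda>x. \<rho> t sq Oe x *\<^sub>R s t sq g x Os Oe)"
      using int by (cases sq) auto
    have "(LINT x|lebesgue. \<rho> t sq ?Oe' x *\<^sub>R s t sq ?g' x Os ?Oe') =
        (LINT x|lebesgue. R *v (\<rho> t sq Oe x *\<^sub>R s t sq g x Os Oe))"
      by (subst change) (simp add: rho_inv[OF dg Oe] s_eq matrix_vector_mult_scaleR)
    also have "\<dots> = R *v (LINT x|lebesgue. \<rho> t sq Oe x *\<^sub>R s t sq g x Os Oe)"
      by (rule integral_bounded_linear[OF R_bl int_sq])
    finally show ?thesis .
  qed
  have nu: "score_nu (\<rho> t) (s t) ?g' Os ?Oe' = R *v score_nu (\<rho> t) (s t) g Os Oe"
    by (simp add: score_nu_def integral_R)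
  let ?torque = "\<lambda>x. \<rho> t Nu Oe x *\<^sub>R cross3 x (s t Nu g x Os Oe)"
    and ?force = "\<lambda>x. \<rho> t Nu Oe x *\<^sub>R s t Nu g x Os Oe"
  have "(LINT x|lebesgue. \<rho> t Nu ?Oe' x *\<^sub>R cross3 x (s t Nu ?g' x Os ?Oe')) =
      (LINT x|lebesgue. \<rho> t Nu Oe x *\<^sub>R cross3 (R *v x + p) (R *v s t Nu g x Os Oe))"
    by (subst change) (simp add: rho_inv[OF dg Oe] s_eq, simp add: pR)
  \<comment> \<open>Pointwise, as a rotation commutes with the cross product; this is where
    \<open>det R = 1\<close> enters besides the change of variables.\<close>
  also have "\<dots> = (LINT x|lebesgue. R *v ?torque x + cross3 p (R *v ?force x))"
    using R by (simp add: cross_add_left cross_rotation_matrix rotation_matrix_def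
        matrix_vector_mult_scaleR cross_mult_right scaleR_add_right)
  \<comment> \<open>Splitting the sum requires both summands to be integrable; they are bounded
    linear images of the torque and force integrands.\<close>
  also have "\<dots> = R *v (LINT x|lebesgue. ?torque x) + cross3 p (R *v (LINT x|lebesgue. ?force x))"
    using integrable_bounded_linear[OF R_bl int(3)] integrable_bounded_linear[OF pR_bl int(1)]
    by (simp add: integral_bounded_linear[OF R_bl int(3)] integral_bounded_linear[OF pR_bl int(1)])
  finally have omega: "score_omega (\<rho> t) (s t) ?g' Os ?Oe' =
      R *v score_omega (\<rho> t) (s t) g Os Oe + cross3 p (R *v score_nu (\<rho> t) (s t) g Os Oe)"
    by (simp add: score_omega_def score_nu_def integral_R matrix_vector_right_distrib)
  \<comment> \<open>The lower row of the block product is \<open>omega\<close> with its two summands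
    swapped; the upper row is \<open>nu\<close>.\<close>
  show "score (\<rho> t) (s t) ?g' Os ?Oe' = inv_transpose (Ad dg) *v score (\<rho> t) (s t) g Os Oe"
    unfolding score_def nu omega
    by (simp only: pR inv_transpose_Ad[OF R(1)] block_matrix_mult_direct_sum
        flip: matrix_vector_mul_assoc) (simp add: hat_mult_vec add.commute)
qed

end
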